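(* Let $(\mathbb{Z},b,\mathcal{D})$ be a number system, where $b\le -3$, and put $B=|b|$. Assume $|d'|\le B$ for all $d'\in\mathcal{D}$. Fix some $d\in\mathcal{D}$ and some integer $u$ with $|u|\le B-1$; if $0\notin\mathcal{D}$, assume moreover $|u|\le B-2$. Let $\mathcal{B}$ be the set of digits in $\mathcal{D}$ that occur in the (minimal-length) expansions in base $b$ with digits in $\mathcal{D}$ of the integers $0$, $u+1$, $u$, and $u-1$. If $d\notin\mathcal{B}$, then for every integer $k\ge 1$, putting $\tilde d=d-ub^k$ and $\tilde{\mathcal{D}}=(\mathcal{D}\setminus\{d\})\cup\{\tilde d\}$, the triple $(\mathbb{Z},b,\tilde{\mathcal{D}})$ is again a number system.
   Context: A pre-number system $(\mathbb{Z},b,\mathcal{D})$ consists of an integer $b$ (the base) with $|b|\ge 2$ and a finite set $\mathcal{D}\subset\mathbb{Z}$ (the digit set) covering all residue classes modulo $b$. Digit sets are assumed irredundant: $|\mathcal{D}|=|b|$, so $\mathcal{D}$ contains exactly one element of each residue class modulo $b$. The pre-number system is a number system if every $a\in\mathbb{Z}$ can be written as $a=\sum_{i=0}^{\ell-1}d_ib^i$ with $\ell\ge 1$ and all $d_i\in\mathcal{D}$. In a number system every integer $a$ (including $0$) has a unique such expansion of minimal length $\ell\ge 1$; "the expansion of $a$" means this one (for $a=0$ it is the digit sequence $(0)$ if $0\in\mathcal{D}$, and otherwise the shortest nonempty digit sequence with value $0$). *)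

theory Defs
  imports Complex_Main "HOL-Number_Theory.Cong"
begin

definition pre_number_system :: "int \<Rightarrow> int set \<Rightarrow> bool" where
  "pre_number_system b D \<longleftrightarrow>
     \<bar>b\<bar> \<ge> 2 \<and> finite D \<and> (\<forall>a. \<exists>d\<in>D. [a = d] (mod b))"

definition irredundant :: "int \<Rightarrow> int set \<Rightarrow> bool" where
  "irredundant b D \<longleftrightarrow> int (card D) = \<bar>b\<bar>"

text \<open>Digit sequences are lists with the least significant digit first.\<close>

definition digits_value :: "int \<Rightarrow> int list \<Rightarrow> int" where
  "digits_value b ds = (\<Sum>i<length ds. ds ! i * b ^ i)"

definition represents :: "int \<Rightarrow> int set \<Rightarrow> int list \<Rightarrow> int \<Rightarrow> bool" where
  "represents b D ds a \<longleftrightarrow> ds \<noteq> [] \<and> set ds \<subseteq> D \<and> digits_value b ds = a"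

definition number_system :: "int \<Rightarrow> int set \<Rightarrow> bool" where
  "number_system b D \<longleftrightarrow>
     pre_number_system b D \<and> irredundant b D \<and> (\<forall>a. \<exists>ds. represents b D ds a)"

definition minimal_expansion :: "int \<Rightarrow> int set \<Rightarrow> int \<Rightarrow> int list \<Rightarrow> bool" where
  "minimal_expansion b D a ds \<longleftrightarrow>
     represents b D ds a \<and> (\<forall>es. represents b D es a \<longrightarrow> length ds \<le> length es)"

text \<open>The definite description is justified by \<open>minimal_expansion_ex1\<close> below.\<close>

definition expansion :: "int \<Rightarrow> int set \<Rightarrow> int \<Rightarrow> int list" where
  "expansion b D a = (THE ds. minimal_expansion b D a ds)"

lemma digits_value_Nil [simp]: "digits_value b [] = 0"
  by (simp add: digits_value_def)

lemma digits_value_Cons [simp]: "digits_value b (d # ds) = d + b * digits_value b ds"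
  by (simp add: digits_value_def sum.lessThan_Suc_shift sum_distrib_left mult_ac del: sum.lessThan_Suc)

lemma irredundant_unique:
  assumes "pre_number_system b D" "irredundant b D" "x \<in> D" "y \<in> D" "[x = y] (mod b)"
  shows "x = y"
proof -
  have fin: "finite D" and b: "\<bar>b\<bar> \<ge> 2" and cov: "\<And>a. \<exists>d\<in>D. a mod b = d mod b"
    using assms(1) by (auto simp: pre_number_system_def cong_def)
  define R where "R = (if b > 0 then {0..<b} else {b<..0})"
  have "R \<subseteq> (\<lambda>d. d mod b) ` D"
  proof
    fix r assume "r \<in> R"
    then have "r mod b = r"
      by (auto simp: R_def mod_pos_pos_trivial mod_neg_neg_trivial split: if_splits)
    with cov[of r] show "r \<in> (\<lambda>d. d mod b) ` D" by force
  qed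
  then have "card R \<le> card ((\<lambda>d. d mod b) ` D)"
    using fin by (intro card_mono) auto
  moreover have "card R = card D"
    using assms(2) b by (auto simp: R_def irredundant_def)
  ultimately have "card ((\<lambda>d. d mod b) ` D) = card D"
    using card_image_le[OF fin, of "\<lambda>d. d mod b"] by linarith
  then have "inj_on (\<lambda>d. d mod b) D"
    using fin by (simp add: eq_card_imp_inj_on)
  then show ?thesis
    using assms(3-5) by (auto simp: cong_def inj_on_def)
qed

lemma same_length_unique:
  assumes "pre_number_system b D" "irredundant b D"
    and "set ds \<subseteq> D" "set es \<subseteq> D" "length ds = length es"
    and "digits_value b ds = digits_value b es"
  shows "ds = es"
  using assms(5,3,4,6)
proof (induction ds es rule: list_induct2)
  case Nil
  then show ?case by simp
next
  case (Cons x xs y ys)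
  have eq: "x + b * digits_value b xs = y + b * digits_value b ys"
    using Cons.prems by simp
  have "[x = y] (mod b)"
    unfolding cong_def using arg_cong[OF eq, of "\<lambda>z. z mod b"] by simp
  then have xy: "x = y"
    using irredundant_unique[OF assms(1,2)] Cons.prems by auto
  have "b \<noteq> 0" using assms(1) by (auto simp: pre_number_system_def)
  then have "digits_value b xs = digits_value b ys" using eq xy by simp
  then show ?case using Cons xy by auto
qed

lemma minimal_expansion_ex1:
  assumes "number_system b D"
  shows "\<exists>!ds. minimal_expansion b D a ds"
proof -
  obtain ds0 where "represents b D ds0 a"
    using assms by (auto simp: number_system_def)
  then obtain ds where ds: "minimal_expansion b D a ds"
    unfolding minimal_expansion_def
    using ex_has_least_nat[of "\<lambda>ds. represents b D ds a" ds0 length] by blast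
  moreover have "es = ds" if "minimal_expansion b D a es" for es
  proof (rule same_length_unique)
    show "pre_number_system b D" "irredundant b D"
      using assms by (auto simp: number_system_def)
    show "length es = length ds"
      using ds that by (auto simp: minimal_expansion_def intro: antisym)
  qed (use ds that in \<open>auto simp: minimal_expansion_def represents_def\<close>)
  ultimately show ?thesis by blast
qed

end

theory Submission
  imports Defs
begin

text \<open>
  Replacing \<open>d\<close> by \<open>d - u b\<^sup>k\<close> changes the division step \<open>T\<close> of \<open>D\<close> only in that every
  occurrence of \<open>d\<close> creates a carry \<open>u\<close>, which is consumed \<open>k\<close> steps later. Subtracting the
  pending carries from the new orbit leaves a sequence \<open>z\<close> with \<open>z\<^sub>m\<^sub>+\<^sub>1 = T (z\<^sub>m)\<close> or
  \<open>z\<^sub>m\<^sub>+\<^sub>1 = T (z\<^sub>m + u)\<close>, according to whether a carry arrives. The size conditions on the digits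
  and \<open>u\<close>, together with \<open>b < 0\<close>, force \<open>\<bar>z\<^sub>m\<bar> \<le> 1\<close> eventually. If a carry arrives after
  that, the division step is applied to one of \<open>u - 1\<close>, \<open>u\<close>, \<open>u + 1\<close>, whose expansions do not
  contain \<open>d\<close>; so \<open>d\<close> is never used again. In either case only finitely many carries occur, and
  from some point on the new orbit is an orbit of \<open>T\<close>, which reaches \<open>0\<close>.
\<close>

section \<open>Division with remainder in a complete residue system\<close>

locale digit_system =
  fixes b :: int and D :: "int set"
  assumes pre: "pre_number_system b D" and irr: "irredundant b D"
begin

definition digit :: "int \<Rightarrow> int" where
  "digit x = (THE e. e \<in> D \<and> [x = e] (mod b))"

definition quot :: "int \<Rightarrow> int" where
  "quot x = (x - digit x) div b"

lemma base_nonzero: "b \<noteq> 0"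
  using pre by (auto simp: pre_number_system_def)

lemma digit_props: "digit x \<in> D" "[x = digit x] (mod b)"
proof -
  have "\<exists>!e. e \<in> D \<and> [x = e] (mod b)"
  proof -
    obtain e where "e \<in> D" "[x = e] (mod b)"
      using pre by (auto simp: pre_number_system_def)
    then show ?thesis
      using irredundant_unique[OF pre irr] by (metis cong_sym cong_trans)
  qed
  from theI'[OF this] show "digit x \<in> D" "[x = digit x] (mod b)"
    by (auto simp: digit_def)
qed

lemma digit_quot: "x = digit x + b * quot x"
proof -
  have "b dvd x - digit x"
    using digit_props(2)[of x] by (simp add: cong_iff_dvd_diff)
  then show ?thesis by (simp add: quot_def)
qed

lemma digit_unique:
  assumes "e \<in> D"
  shows "digit (e + b * t) = e"
proof -
  have "[digit (e + b * t) = e + b * t] (mod b)"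
    using digit_props(2) cong_sym by blast
  also have "[e + b * t = e] (mod b)" by (simp add: cong_def)
  finally show ?thesis
    using irredundant_unique[OF pre irr digit_props(1) assms] by blast
qed

lemma quot_unique: "e \<in> D \<Longrightarrow> quot (e + b * t) = t"
  using digit_unique base_nonzero by (simp add: quot_def)

lemma digit_add_mult: "digit (x + b * t) = digit x"
  using digit_unique[OF digit_props(1), of x "quot x + t"] digit_quot[of x]
  by (simp add: algebra_simps)

lemma quot_add_mult: "quot (x + b * t) = quot x + t"
  using quot_unique[OF digit_props(1), of x "quot x + t"] digit_quot[of x]
  by (simp add: algebra_simps)

text \<open>A digit sequence is determined by its value one digit at a time, so every expansion of
  \<open>x m\<close> just lists digits along the orbit.\<close>

lemma digits_avoid_of_orbit_avoids:
  assumes "\<And>m. m \<ge> M \<Longrightarrow> digit (x m) \<noteq> d" and "\<And>m. m \<ge> M \<Longrightarrow> x (Suc m) = quot (x m)"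
    and "set ds \<subseteq> D" "digits_value b ds = x m" "m \<ge> M"
  shows "d \<notin> set ds"
  using assms(3-5)
proof (induction ds arbitrary: m)
  case Nil
  then show ?case by simp
next
  case (Cons e es)
  have xm: "x m = e + b * digits_value b es" and e: "e \<in> D"
    using Cons.prems by auto
  have "digits_value b es = x (Suc m)"
    using quot_unique[OF e] assms(2)[OF Cons.prems(3)] xm by simp
  then have "d \<notin> set es" using Cons by simp
  moreover have "e \<noteq> d"
    using digit_unique[OF e] assms(1)[OF Cons.prems(3)] xm by metis
  ultimately show ?case by auto
qed

text \<open>Exchanging a digit within its residue class keeps covering and cardinality, which leaves
  only the existence of representations to check.\<close>

lemma number_system_replace_digit:
  assumes "d \<in> D" "b dvd d - d'"
    and rep: "\<And>a. \<exists>ds. represents b ((D - {d}) \<union> {d'}) ds a"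
  shows "number_system b ((D - {d}) \<union> {d'})"
proof -
  let ?D' = "(D - {d}) \<union> {d'}"
  have fin: "finite D" and b: "\<bar>b\<bar> \<ge> 2"
    using pre by (auto simp: pre_number_system_def)
  have d': "[d = d'] (mod b)" using assms(2) by (simp add: cong_iff_dvd_diff)
  have "\<exists>e\<in>?D'. [a = e] (mod b)" for a
  proof (cases "digit a = d")
    case True
    then have "[a = d'] (mod b)" using digit_props(2)[of a] d' cong_trans by blast
    then show ?thesis by blast
  next
    case False
    then show ?thesis using digit_props[of a] by blast
  qed
  then have "pre_number_system b ?D'" using b fin by (simp add: pre_number_system_def)
  moreover have "d' \<notin> D - {d}"
    using irredundant_unique[OF pre irr assms(1) _ d'] by blast
  then have "card ?D' = card D"
    using fin assms(1) by (simp add: card_Suc_Diff1 del: card_Diff_singleton card_Diff_insert)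
  then have "irredundant b ?D'" using irr by (simp add: irredundant_def)
  ultimately show ?thesis using rep by (simp add: number_system_def)
qed

end

lemma expansion_represents:
  assumes "number_system b D"
  shows "represents b D (expansion b D a) a"
  using theI'[OF minimal_expansion_ex1[OF assms, of a]]
  by (simp add: expansion_def minimal_expansion_def)

section \<open>Size estimates for orbits with carries\<close>

text \<open>The exceptional case for \<open>\<bar>v\<bar> = 2\<close> cannot occur twice in a row: since \<open>b < 0\<close>, the sign
  changes from \<open>v\<close> to \<open>w\<close>, but it has to be the sign of \<open>u\<close>.\<close>

lemma carry_step_bound:
  fixes b u v w c e :: int
  assumes "b \<le> -3" and step: "v + c = e + b * w" and c: "c = 0 \<or> c = u"
    and e: "\<bar>e\<bar> \<le> \<bar>b\<bar>" and ue: "\<bar>u\<bar> + \<bar>e\<bar> \<le> 2 * \<bar>b\<bar> - 2"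
  shows "\<bar>v\<bar> \<le> 1 \<Longrightarrow> \<bar>w\<bar> \<le> 1"
    and "\<bar>v\<bar> = 2 \<Longrightarrow> \<bar>w\<bar> \<le> 1 \<or> (v * u > 0 \<and> v * w < 0 \<and> \<bar>w\<bar> = 2)"
    and "\<bar>v\<bar> \<ge> 3 \<Longrightarrow> \<bar>w\<bar> < \<bar>v\<bar>"
proof -
  define B where "B = - b"
  have B: "b = - B" "\<bar>b\<bar> = B" "B \<ge> 3" using assms(1) by (auto simp: B_def)
  have "\<bar>B * w\<bar> \<le> \<bar>v\<bar> + 2 * B - 2"
    using step c ue B by (elim disjE) simp_all
  then have le: "B * \<bar>w\<bar> \<le> \<bar>v\<bar> + 2 * B - 2"
    using B by (simp add: abs_mult)
  show "\<bar>w\<bar> \<le> 1" if "\<bar>v\<bar> \<le> 1"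
  proof (rule ccontr)
    assume "\<not> \<bar>w\<bar> \<le> 1"
    then have "B * 2 \<le> B * \<bar>w\<bar>" using B by (intro mult_left_mono) auto
    then show False using le that by linarith
  qed
  show "\<bar>w\<bar> < \<bar>v\<bar>" if "\<bar>v\<bar> \<ge> 3"
  proof (rule ccontr)
    assume "\<not> \<bar>w\<bar> < \<bar>v\<bar>"
    then have "B * \<bar>v\<bar> \<le> B * \<bar>w\<bar>" using B by (intro mult_left_mono) auto
    moreover have "(B - 1) * 3 \<le> (B - 1) * \<bar>v\<bar>" using B that by (intro mult_left_mono) auto
    then have "B * 3 - 3 \<le> B * \<bar>v\<bar> - \<bar>v\<bar>" by (simp add: algebra_simps)
    ultimately show False using le B by linarith
  qed
  show "\<bar>w\<bar> \<le> 1 \<or> (v * u > 0 \<and> v * w < 0 \<and> \<bar>w\<bar> = 2)" if v: "\<bar>v\<bar> = 2"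
  proof (cases "\<bar>w\<bar> \<le> 1")
    case False
    have "\<bar>w\<bar> \<le> 2"
    proof (rule ccontr)
      assume "\<not> \<bar>w\<bar> \<le> 2"
      then have "B * 3 \<le> B * \<bar>w\<bar>" using B by (intro mult_left_mono) auto
      then show False using le v B by linarith
    qed
    with False have "w = 2 \<or> w = -2" by linarith
    moreover have "v = 2 \<or> v = -2" using v by linarith
    \<comment> \<open>Here \<open>c = 0\<close> would give \<open>2 * B \<le> B + 2\<close>. So
      \<open>c = u\<close>, and equality in the triangle inequality makes \<open>v\<close>,
      \<open>u\<close> and \<open>- w\<close> agree in sign.\<close>
    ultimately show ?thesis
      using step c e ue B by auto
  qed simp
qed

text \<open>From 3 on the absolute value drops strictly, the value 2 occurs at most twice in
  succession, and the range from -1 to 1 is never left.\<close>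

lemma carry_orbit_eventually_small:
  fixes b u :: int and z c e :: "nat \<Rightarrow> int"
  assumes b: "b \<le> -3" and step: "\<And>m. z m + c m = e m + b * z (Suc m)"
    and c: "\<And>m. c m = 0 \<or> c m = u"
    and e: "\<And>m. \<bar>e m\<bar> \<le> \<bar>b\<bar>" and ue: "\<And>m. \<bar>u\<bar> + \<bar>e m\<bar> \<le> 2 * \<bar>b\<bar> - 2"
  shows "\<exists>N. \<forall>m\<ge>N. \<bar>z m\<bar> \<le> 1"
proof -
  note bound = carry_step_bound[OF b step c e ue]
  have "\<exists>N. \<bar>z N\<bar> \<le> 1"
  proof -
    have "\<exists>N. \<bar>z N\<bar> \<le> 1" for m :: nat
    proof (induction "nat \<bar>z m\<bar>" arbitrary: m rule: less_induct)
      case less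
      consider "\<bar>z m\<bar> \<le> 1" | "\<bar>z m\<bar> = 2" | "\<bar>z m\<bar> \<ge> 3" by linarith
      then show ?case
      proof cases
        case 2
        show ?thesis
        proof (rule ccontr)
          assume large: "\<nexists>N. \<bar>z N\<bar> \<le> 1"
          from bound(2)[OF 2] large
          have 1: "z m * u > 0" "z m * z (Suc m) < 0" "\<bar>z (Suc m)\<bar> = 2" by blast+
          from bound(2)[OF 1(3)] large have "z (Suc m) * u > 0" by blast
          with 1 show False by (auto simp: zero_less_mult_iff mult_less_0_iff)
        qed
      next
        case 3
        then have "nat \<bar>z (Suc m)\<bar> < nat \<bar>z m\<bar>" using bound(3)[OF 3] by linarith
        then show ?thesis by (rule less)
      qed blast
    qed
    then show ?thesis by blast
  qed
  then obtain N where N: "\<bar>z N\<bar> \<le> 1" by blast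
  have "\<bar>z m\<bar> \<le> 1" if "m \<ge> N" for m
    using that by (induction m rule: dec_induct) (use N bound(1) in auto)
  then show ?thesis by blast
qed

theorem theorem3p14:
  fixes b d u :: int and D Bset :: "int set"
  assumes "number_system b D" and "b \<le> -3"
    and "\<forall>d'\<in>D. \<bar>d'\<bar> \<le> \<bar>b\<bar>"
    and "d \<in> D"
    and "\<bar>u\<bar> \<le> \<bar>b\<bar> - 1"
    and "0 \<notin> D \<longrightarrow> \<bar>u\<bar> \<le> \<bar>b\<bar> - 2"
    and "Bset = (\<Union>a\<in>{0, u + 1, u, u - 1}. set (expansion b D a))"
    and "d \<notin> Bset"
  shows "\<forall>k::nat. k \<ge> 1 \<longrightarrow> number_system b ((D - {d}) \<union> {d - u * b ^ k})"
proof (intro allI impI)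
  fix k :: nat
  assume "k \<ge> 1"
  then obtain k' where k: "k = Suc k'" by (cases k) auto
  interpret digit_system b D
    using assms(1) by unfold_locales (auto simp: number_system_def)
  define d' where "d' = d - u * b ^ k"

  \<comment> \<open>Sequences must be nonempty so that membership in \<open>S\<close> determines a
    first digit other than \<open>d\<close>.\<close>
  define S where "S = {x. \<exists>ds. ds \<noteq> [] \<and> set ds \<subseteq> D - {d} \<and> digits_value b ds = x}"
  have in_S: "a \<in> S" if "a \<in> {0, u + 1, u, u - 1}" for a
  proof -
    have "d \<notin> set (expansion b D a)" using assms(7,8) that by blast
    then show ?thesis
      using expansion_represents[OF assms(1), of a] unfolding S_def represents_def by blast
  qed
  have S_step: "digit x \<noteq> d \<and> quot x \<in> S" if "x \<in> S" for x
  proof -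
    from that obtain e es where e: "e \<in> D" "e \<noteq> d" and es: "set es \<subseteq> D - {d}"
      and x: "x = e + b * digits_value b es"
      unfolding S_def by (auto simp: neq_Nil_conv)
    have "digits_value b es \<in> S"
    \<comment> \<open>A one-digit sequence leaves the quotient 0; this is why the expansion of 0 has
      to avoid \<open>d\<close> as well.\<close>
    proof (cases "es = []")
      case True
      then show ?thesis using in_S[of 0] by simp
    next
      case False
      then show ?thesis using es by (auto simp: S_def)
    qed
    then show ?thesis using digit_unique[OF e(1)] quot_unique[OF e(1)] e(2) x by simp
  qed

  have digit_bound: "\<bar>e\<bar> \<le> \<bar>b\<bar>" "\<bar>u\<bar> + \<bar>e\<bar> \<le> 2 * \<bar>b\<bar> - 2" if e: "e \<in> D" for e
  proof -
    show le: "\<bar>e\<bar> \<le> \<bar>b\<bar>" using assms(3) e by blast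
    show "\<bar>u\<bar> + \<bar>e\<bar> \<le> 2 * \<bar>b\<bar> - 2"
    proof (cases "0 \<in> D")
      case True
      \<comment> \<open>When 0 is a digit, no other digit is divisible by \<open>b\<close>; the gain
        of 1 makes up for the weaker bound on \<open>u\<close>.\<close>
      have "\<bar>e\<bar> \<noteq> \<bar>b\<bar>"
      proof
        assume eb: "\<bar>e\<bar> = \<bar>b\<bar>"
        then have "b dvd e" by (metis abs_dvd_iff dvd_abs_iff dvd_refl)
        then have "[e = 0] (mod b)" by (simp add: cong_0_iff)
        then have "e = 0" using irredundant_unique[OF pre irr e True] by blast
        with eb base_nonzero show False by simp
      qed
      then show ?thesis using le assms(5) by linarith
    next
      case False
      then show ?thesis using le assms(6) by auto
    qed
  qed

  have "\<exists>ds. represents b ((D - {d}) \<union> {d'}) ds a" for a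
  proof -
    \<comment> \<open>The division step of the new digit set: using \<open>d'\<close> in place of
      \<open>d\<close> raises the quotient by \<open>u * b ^ (k - 1)\<close>.\<close>
    define T where "T x = quot x + (if digit x = d then u * b ^ k' else 0)" for x
    define x where "x n = (T ^^ n) a" for n
    define c where "c n = (if digit (x n) = d then u else 0)" for n
    \<comment> \<open>A carry created at step \<open>m + j\<close> has been divided down to
      \<open>c (m + j) * b ^ j\<close> by step \<open>m + k\<close>; the term \<open>j = 0\<close>
      is the one now due.\<close>
    define z where "z m = x (m + k) - (\<Sum>j<k. c (m + j) * b ^ j)" for m
    have x_Suc: "x (Suc n) = quot (x n) + c n * b ^ k'" for n
      by (simp add: x_def c_def T_def)
    have x_split: "x (m + k) = (z m + c m) + b * (\<Sum>j<k'. c (Suc m + j) * b ^ j)" for m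
      unfolding z_def k
      by (simp add: sum.lessThan_Suc_shift sum_distrib_left mult_ac del: sum.lessThan_Suc)
    have digit_x: "digit (x (m + k)) = digit (z m + c m)" for m
      unfolding x_split by (rule digit_add_mult)
    have z_Suc: "z (Suc m) = quot (z m + c m)" for m
    proof -
      have "x (Suc m + k) = quot (x (m + k)) + c (m + k) * b ^ k'"
        using x_Suc[of "m + k"] by simp
      also have "quot (x (m + k)) = quot (z m + c m) + (\<Sum>j<k'. c (Suc m + j) * b ^ j)"
        unfolding x_split by (rule quot_add_mult)
      finally show ?thesis
        unfolding z_def[of "Suc m"] by (simp add: k)
    qed
    have "\<exists>N. \<forall>m\<ge>N. \<bar>z m\<bar> \<le> 1"
    proof (rule carry_orbit_eventually_small[OF assms(2)])
      show "z m + c m = digit (z m + c m) + b * z (Suc m)" for m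
        using digit_quot z_Suc by simp
      show "c m = 0 \<or> c m = u" for m by (simp add: c_def)
    qed (use digit_bound digit_props(1) in blast)+
    then obtain N where N: "\<And>m. m \<ge> N \<Longrightarrow> \<bar>z m\<bar> \<le> 1" by blast

    have "\<exists>M. \<forall>m\<ge>M. digit (x m) \<noteq> d"
    proof (cases "\<exists>m\<ge>N. digit (x m) = d")
      case True
      then obtain n where n: "n \<ge> N" "digit (x n) = d" by blast
      have carry: "z m + c m \<in> S" if "m \<ge> N" "digit (x m) = d" for m
      proof -
        have "c m = u" using that by (simp add: c_def)
        moreover have "z m = -1 \<or> z m = 0 \<or> z m = 1" using N[OF that(1)] by linarith
        ultimately show ?thesis using in_S[of "z m + c m"] by auto
      qed
      \<comment> \<open>Each step either takes a quotient inside \<open>S\<close> or meets a new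
        carry, which restarts at \<open>u - 1\<close>, \<open>u\<close> or
        \<open>u + 1\<close>.\<close>
      have "z m + c m \<in> S" if "m \<ge> n" for m
        using that
      proof (induction m rule: dec_induct)
        case base
        then show ?case using carry n by blast
      next
        case (step m)
        show ?case
        proof (cases "digit (x (Suc m)) = d")
          case True
          then show ?thesis using carry step n by simp
        next
          case False
          then show ?thesis using S_step[OF step.IH] z_Suc by (simp add: c_def)
        qed
      qed
      then have "digit (x (m + k)) \<noteq> d" if "m \<ge> n" for m
        using that S_step digit_x by simp
      then have "digit (x m) \<noteq> d" if "m \<ge> n + k" for m
        using that by (metis add_leE le_add_diff_inverse2 le_diff_conv2)
      then show ?thesis by blast
    qed blast
    then obtain M where M: "\<And>m. m \<ge> M \<Longrightarrow> digit (x m) \<noteq> d" by blast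
    obtain ds where ds: "represents b D ds (x M)"
      using assms(1) by (auto simp: number_system_def)
    have "d \<notin> set ds"
      by (rule digits_avoid_of_orbit_avoids[where x = x and M = M and m = M])
        (use M ds x_Suc in \<open>auto simp: c_def represents_def\<close>)
    then have "represents b ((D - {d}) \<union> {d'}) ds (x M)"
      using ds by (auto simp: represents_def)
    moreover have "\<exists>es. represents b ((D - {d}) \<union> {d'}) es (x n)"
      if "represents b ((D - {d}) \<union> {d'}) fs (x (Suc n))" for fs n
    proof -
      define e where "e = (if digit (x n) = d then d' else digit (x n))"
      have "x n = e + b * x (Suc n)"
        using digit_quot[of "x n"] x_Suc[of n]
        by (auto simp: e_def d'_def c_def k algebra_simps)
      then have "represents b ((D - {d}) \<union> {d'}) (e # fs) (x n)"
        using that digit_props(1)[of "x n"] by (auto simp: represents_def e_def)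
      then show ?thesis by blast
    qed
    \<comment> \<open>Running the orbit backwards from \<open>x M\<close> to \<open>x 0 = a\<close>
      prepends one new digit per step.\<close>
    ultimately have "\<exists>es. represents b ((D - {d}) \<union> {d'}) es (x 0)"
      using inc_induct[of 0 M "\<lambda>n. \<exists>es. represents b ((D - {d}) \<union> {d'}) es (x n)"] by blast
    then show ?thesis by (simp add: x_def)
  qed
  then show "number_system b ((D - {d}) \<union> {d - u * b ^ k})"
    using number_system_replace_digit[OF assms(4), of d'] by (simp add: d'_def k)
qed

end
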